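(* For every graph $G$ and every integer $d\geq 2$, $$\chi(G^d)\leq\begin{cases}\omega(G^d)^2 & \text{if } d \text{ is even},\\ \omega(G^d)^3 & \text{if } d\text{ is odd}.\end{cases}$$
   Context: All graphs are finite, simple and undirected. $G^d$ is the graph on $V(G)$ where distinct $u,v$ are adjacent iff their distance in $G$ is at most $d$. $\chi$ denotes chromatic number and $\omega$ clique number. *)

theory Defs
  imports "Graph_Theory.Graph_Theory"
begin

text \<open>
  A finite simple undirected graph is a \<^locale>\<open>pair_graph\<close>: an edge $uv$ is represented by the
  two arcs $(u,v)$ and $(v,u)$.
\<close>

text \<open>
  The distance is the library's shortest-path cost for unit arc weights; it is
  infinite between different components.
\<close>
definition graph_dist :: "'a pair_pre_digraph \<Rightarrow> 'a \<Rightarrow> 'a \<Rightarrow> ereal" where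
  "graph_dist G u v = wf_digraph.\<mu> (with_proj G) (\<lambda>_. 1) u v"

definition graph_power :: "'a pair_pre_digraph \<Rightarrow> nat \<Rightarrow> 'a pair_pre_digraph" where
  "graph_power G d =
     \<lparr> pverts = pverts G,
       parcs = {(u, v). u \<in> pverts G \<and> v \<in> pverts G \<and> u \<noteq> v \<and>
                        graph_dist G u v \<le> ereal (real d)} \<rparr>"

definition is_clique :: "'a pair_pre_digraph \<Rightarrow> 'a set \<Rightarrow> bool" where
  "is_clique G K \<longleftrightarrow>
     K \<subseteq> pverts G \<and> (\<forall>u\<in>K. \<forall>v\<in>K. u \<noteq> v \<longrightarrow> (u, v) \<in> parcs G)"

definition clique_number :: "'a pair_pre_digraph \<Rightarrow> nat" where
  "clique_number G = Max (card ` {K. is_clique G K})"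

definition proper_coloring :: "'a pair_pre_digraph \<Rightarrow> nat \<Rightarrow> ('a \<Rightarrow> nat) \<Rightarrow> bool" where
  "proper_coloring G k c \<longleftrightarrow>
     c ` pverts G \<subseteq> {..<k} \<and> (\<forall>(u, v)\<in>parcs G. c u \<noteq> c v)"

definition chromatic_number :: "'a pair_pre_digraph \<Rightarrow> nat" where
  "chromatic_number G = (LEAST k. \<exists>c. proper_coloring G k c)"

end

theory Submission
  imports Defs
begin

text \<open>
  Let $\omega$ be the clique number of $G^d$. A ball of radius $n$ with $2n \le d$ is a clique of
  $G^d$, so it has at most $\omega$ vertices. A ball of radius $2r$ is covered by the balls of radius
  $r$ around the points of a ball of radius $r$, hence has at most $\omega^2$ vertices; one further
  step of radius $1$ costs another factor $\omega$. As the closed neighbourhood of a vertex in $G^d$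
  is its ball of radius $d$, greedy colouring gives the bound.
\<close>

text \<open>Vertices are coloured one at a time: fewer than \<open>k\<close> neighbours block fewer
  than \<open>k\<close> colours. Degrees are counted in all of \<open>r\<close>, not only inside
  \<open>A\<close>, so the hypothesis passes unchanged to smaller sets in the induction.\<close>

lemma greedy_coloring:
  fixes r :: "'a rel"
  assumes "finite A" "sym r" "irrefl r"
    and deg: "\<And>v. v \<in> A \<Longrightarrow> finite (r `` {v}) \<and> card (r `` {v}) < k"
  shows "\<exists>c. c ` A \<subseteq> {..<k} \<and> (\<forall>u\<in>A. \<forall>v\<in>A. (u, v) \<in> r \<longrightarrow> c u \<noteq> c v)"
  using assms(1) deg
proof (induction A rule: finite_induct)
  case empty
  then show ?case by simp
next
  case (insert x F)
  then obtain c where c: "c ` F \<subseteq> {..<k}" "\<forall>u\<in>F. \<forall>v\<in>F. (u, v) \<in> r \<longrightarrow> c u \<noteq> c v"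
    by (metis insertI2)
  have "finite (r `` {x})" "card (r `` {x}) < k"
    using insert.prems by auto
  \<comment> \<open>Neighbours of \<open>x\<close> outside \<open>F\<close> have arbitrary values
    under \<open>c\<close>; counting them as blocked is harmless, since the bound covers all
    neighbours.\<close>
  then have "card (c ` (r `` {x})) < card {..<k}"
    using card_image_le[of "r `` {x}" c] by simp
  then have "\<not> {..<k} \<subseteq> c ` (r `` {x})"
    using card_mono \<open>finite (r `` {x})\<close> by (metis finite_imageI not_less)
  then obtain a where a: "a < k" "a \<notin> c ` (r `` {x})"
    by auto
  define c' where "c' = c(x := a)"
  have "c' ` insert x F \<subseteq> {..<k}"
    using c(1) a(1) by (auto simp: c'_def)
  moreover have "c' u \<noteq> c' v"
    if "u \<in> insert x F" "v \<in> insert x F" "(u, v) \<in> r" for u v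
  proof -
    have "(v, u) \<in> r" "u \<noteq> v"
      using that(3) \<open>sym r\<close> \<open>irrefl r\<close> by (auto dest: symD simp: irrefl_def)
    then show ?thesis
      using that c(2) a(2) by (auto simp: c'_def)
  qed
  ultimately show ?case
    by blast
qed

lemma chromatic_number_le:
  assumes "proper_coloring H k c"
  shows "chromatic_number H \<le> k"
  unfolding chromatic_number_def using assms by (blast intro: Least_le)

lemma card_clique_le:
  assumes "finite (pverts H)" "is_clique H K"
  shows "card K \<le> clique_number H"
proof -
  have "{K. is_clique H K} \<subseteq> Pow (pverts H)"
    by (auto simp: is_clique_def)
  then have "finite {K. is_clique H K}"
    using assms(1) by (meson finite_Pow_iff finite_subset)
  then show ?thesis
    unfolding clique_number_def using assms(2) by (intro Max_ge) auto
qed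

lemma card_UN_le_mult:
  assumes "finite A" "card A \<le> m" "\<And>x. x \<in> A \<Longrightarrow> card (B x) \<le> n"
  shows "card (\<Union>x\<in>A. B x) \<le> m * n"
proof -
  have "card (\<Union>x\<in>A. B x) \<le> (\<Sum>x\<in>A. card (B x))"
    using assms(1) by (rule card_UN_le)
  also have "\<dots> \<le> card A * n"
    using sum_bounded_above[of A "\<lambda>x. card (B x)" n] assms(3) by simp
  also have "\<dots> \<le> m * n"
    using assms(2) by simp
  finally show ?thesis .
qed

context pair_graph
begin

text \<open>Arbitrary walks instead of shortest paths make concatenation and cutting immediate. For
  \<open>u\<close> outside the graph the set is empty, so most facts below need no assumption on the
  centre.\<close>

definition walk_ball :: "nat \<Rightarrow> 'a \<Rightarrow> 'a set" where
  "walk_ball n u = {v. \<exists>p. awalk u p v \<and> length p \<le> n}"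

lemma graph_dist_le_iff: "graph_dist G u v \<le> ereal (real n) \<longleftrightarrow> v \<in> walk_ball n u"
proof -
  have cost: "awalk_cost (\<lambda>_. 1) p = real (length p)" for p :: "('a \<times> 'a) list"
    by (induction p) auto
  show ?thesis
  proof
    assume "graph_dist G u v \<le> ereal (real n)"
    \<comment> \<open>The distance is an infimum, so a strict bound is needed to extract a walk;
      integrality of lengths then turns \<open>< Suc n\<close> back into
      \<open>\<le> n\<close>.\<close>
    also have "\<dots> < ereal (real (Suc n))"
      by simp
    finally obtain p where "awalk u p v" "real (length p) < real (Suc n)"
      unfolding graph_dist_def \<mu>_def by (auto simp: INF_less_iff cost)
    then show "v \<in> walk_ball n u"
      by (auto simp: walk_ball_def)
  next
    assume "v \<in> walk_ball n u"
    then obtain p where p: "awalk u p v" "length p \<le> n"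
      by (auto simp: walk_ball_def)
    have "graph_dist G u v \<le> ereal (real (length p))"
      unfolding graph_dist_def using min_cost_le_walk_cost[OF p(1), of "\<lambda>_. 1"] by (simp add: cost)
    also have "\<dots> \<le> ereal (real n)"
      using p(2) by simp
    finally show "graph_dist G u v \<le> ereal (real n)" .
  qed
qed

lemma walk_ball_subset_verts: "walk_ball n u \<subseteq> pverts G"
  by (auto simp: walk_ball_def dest: awalk_last_in_verts)

lemma finite_walk_ball: "finite (walk_ball n u)"
  using walk_ball_subset_verts pair_finite_verts by (rule finite_subset)

lemma center_in_walk_ball: "u \<in> pverts G \<Longrightarrow> u \<in> walk_ball n u"
  by (auto simp: walk_ball_def awalk_Nil_iff intro!: exI[of _ "[]"])

lemma length_rev_path: "length (rev_path p) = length p"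
  by (induction p) auto

lemma walk_ball_sym:
  assumes "v \<in> walk_ball n u"
  shows "u \<in> walk_ball n v"
proof -
  obtain p where "awalk u p v" "length p \<le> n"
    using assms by (auto simp: walk_ball_def)
  then have "awalk v (rev_path p) u" "length (rev_path p) \<le> n"
    by (simp_all add: awalk_rev_path' length_rev_path)
  then show ?thesis
    unfolding walk_ball_def by blast
qed

lemma walk_ball_trans:
  assumes "v \<in> walk_ball m u" "w \<in> walk_ball n v"
  shows "w \<in> walk_ball (m + n) u"
proof -
  obtain p q where "awalk u p v" "length p \<le> m" "awalk v q w" "length q \<le> n"
    using assms by (auto simp: walk_ball_def)
  then have "awalk u (p @ q) w" "length (p @ q) \<le> m + n"
    by (auto intro: awalk_appendI)
  then show ?thesis
    unfolding walk_ball_def by blast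
qed

lemma walk_ball_mono: "m \<le> n \<Longrightarrow> walk_ball m u \<subseteq> walk_ball n u"
  by (auto simp: walk_ball_def intro: order_trans)

text \<open>Cut a walk after its first \<open>m\<close> arcs; if it is shorter than that, the second
  piece is empty.\<close>

lemma walk_ball_add_subset: "walk_ball (m + n) u \<subseteq> (\<Union>v\<in>walk_ball m u. walk_ball n v)"
proof
  fix w assume "w \<in> walk_ball (m + n) u"
  then obtain p where p: "awalk u p w" "length p \<le> m + n"
    by (auto simp: walk_ball_def)
  have "awalk u (take m p @ drop m p) w"
    using p(1) by simp
  then obtain v where "awalk u (take m p) v" "awalk v (drop m p) w"
    unfolding awalk_append_iff by blast
  moreover have "length (take m p) \<le> m" "length (drop m p) \<le> n"
    using p(2) by auto
  ultimately show "w \<in> (\<Union>v\<in>walk_ball m u. walk_ball n v)"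
    unfolding walk_ball_def by blast
qed

text \<open>Any two points of the ball are joined through its centre by a walk of length at most
  \<open>n + n\<close>.\<close>

lemma is_clique_walk_ball:
  assumes "2 * n \<le> d"
  shows "is_clique (graph_power G d) (walk_ball n u)"
proof -
  have "y \<in> walk_ball d x" if "x \<in> walk_ball n u" "y \<in> walk_ball n u" for x y
    using walk_ball_trans[OF walk_ball_sym[OF that(1)] that(2)] walk_ball_mono[of "n + n" d] assms
    by auto
  then show ?thesis
    using walk_ball_subset_verts[THEN subsetD]
    by (auto simp: is_clique_def graph_power_def graph_dist_le_iff)
qed

lemma card_walk_ball_le:
  assumes "2 * n \<le> d"
  shows "card (walk_ball n u) \<le> clique_number (graph_power G d)"
  using card_clique_le[OF _ is_clique_walk_ball[OF assms]] pair_finite_verts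
  by (simp add: graph_power_def)

text \<open>The bound \<open>b\<close> must be uniform, because the small balls are centred at
  varying points of the ball around \<open>u\<close>.\<close>

lemma card_walk_ball_add_le:
  assumes "card (walk_ball m u) \<le> a" "\<And>v. card (walk_ball n v) \<le> b"
  shows "card (walk_ball (m + n) u) \<le> a * b"
proof -
  have "card (walk_ball (m + n) u) \<le> card (\<Union>v\<in>walk_ball m u. walk_ball n v)"
    using walk_ball_add_subset finite_walk_ball by (intro card_mono) auto
  also have "\<dots> \<le> a * b"
    using finite_walk_ball assms by (rule card_UN_le_mult)
  finally show ?thesis .
qed

lemma chromatic_number_power_le:
  assumes "\<And>v. card (walk_ball d v) \<le> k"
  shows "chromatic_number (graph_power G d) \<le> k"
proof -
  let ?r = "parcs (graph_power G d)"
  have r: "?r = {(u, v). u \<in> pverts G \<and> v \<in> walk_ball d u \<and> u \<noteq> v}"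
    using walk_ball_subset_verts[THEN subsetD] by (auto simp: graph_power_def graph_dist_le_iff)
  have "finite (?r `` {v}) \<and> card (?r `` {v}) < k" if "v \<in> pverts G" for v
  proof -
    have "?r `` {v} = walk_ball d v - {v}"
      using that by (auto simp: r)
    \<comment> \<open>Discarding the centre gives the strict inequality that greedy colouring needs,
      hence \<open>k\<close> colours and not \<open>k + 1\<close>.\<close>
    moreover have "card (walk_ball d v - {v}) < card (walk_ball d v)"
      using finite_walk_ball center_in_walk_ball[OF that] by (rule card_Diff1_less)
    ultimately show ?thesis
      using assms[of v] finite_walk_ball by auto
  qed
  moreover have "sym ?r" "irrefl ?r"
    using walk_ball_sym walk_ball_subset_verts[THEN subsetD] by (auto simp: r sym_def irrefl_def)
  ultimately obtain c where c: "c ` pverts G \<subseteq> {..<k}"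
    "\<forall>u\<in>pverts G. \<forall>v\<in>pverts G. (u, v) \<in> ?r \<longrightarrow> c u \<noteq> c v"
    using greedy_coloring[OF pair_finite_verts] by metis
  then have "proper_coloring (graph_power G d) k c"
    by (auto simp: proper_coloring_def graph_power_def)
  then show ?thesis
    by (rule chromatic_number_le)
qed

end

theorem theorem5p2:
  fixes G :: "'a pair_pre_digraph" and d :: nat
  assumes "pair_graph G" and "d \<ge> 2"
  shows "chromatic_number (graph_power G d) \<le>
           (if even d then clique_number (graph_power G d) ^ 2
            else clique_number (graph_power G d) ^ 3)"
proof -
  interpret pair_graph G by fact
  let ?w = "clique_number (graph_power G d)"
  define r where "r = d div 2"
  \<comment> \<open>Rounding down ensures \<open>2 * r \<le> d\<close> for either parity.\<close>
  have r: "card (walk_ball r v) \<le> ?w" for v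
    by (rule card_walk_ball_le) (simp add: r_def)
  have rr: "card (walk_ball (r + r) v) \<le> ?w * ?w" for v
    by (rule card_walk_ball_add_le[OF r r])
  show ?thesis
  proof (cases "even d")
    case True
    then have "d = r + r"
      by (auto simp: r_def)
    then show ?thesis
      using True rr chromatic_number_power_le[of d "?w * ?w"] by (simp add: power2_eq_square)
  next
    case False
    \<comment> \<open>Here \<open>d \<ge> 2\<close> enters: it makes balls of radius 1 cliques of
      the power, which pays for the one step left over when \<open>d\<close> is odd.\<close>
    have one: "card (walk_ball 1 v) \<le> ?w" for v
      using \<open>d \<ge> 2\<close> by (intro card_walk_ball_le) simp
    have "d = r + r + 1"
      using False unfolding r_def by presburger
    moreover have "card (walk_ball (r + r + 1) v) \<le> ?w * ?w * ?w" for v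
      by (rule card_walk_ball_add_le[OF rr one])
    ultimately show ?thesis
      using False chromatic_number_power_le[of d "?w * ?w * ?w"] by (simp add: power3_eq_cube)
  qed
qed

end
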